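(* Let $m\geq 2$ be an integer, let $\omega\in\mathbb{R}$ and let $x_n=x_n(\omega)=\operatorname{tr}(T_n(\omega))$ and $t_n=t_n(\omega)=\operatorname{tr}(T_{n-2}(\omega)T_{n-1}(\omega))$ be associated with the generalised precious mean Fibonacci tiling (parameters $m$ and $l=1$), so that they satisfy the recursion relation $$x_{n+1}=d_m(x_n)t_{n+1}-d_{m-1}(x_n)x_{n-1},\qquad t_{n+1}=d_{m+1}(x_{n-1})t_n-d_m(x_{n-1})x_{n-2},\qquad n\geq 2.$$ Suppose that there exists some $N\in\mathbb{N}$ such that $$|x_N|>2,\qquad |x_{N+1}|\geq |d_{m-1}(x_N)x_N|\qquad\text{and}\qquad |x_{N+2}|\geq |d_{m-1}(x_{N+1})x_{N+1}|.$$ Then $|x_{n+1}|\geq |d_{m-1}(x_n)x_n|$ for all $n>N$. Consequently, $|x_n|>2$ for all $n\geq N$, meaning that $\omega$ is in the super band gap $\mathcal{S}_N$.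
   Context: The polynomials $d_k(x)$ are defined by $d_0(x)=0$, $d_1(x)=1$ and $d_k(x)=x\,d_{k-1}(x)-d_{k-2}(x)$ for $k\geq 2$. Generalised Fibonacci tilings with parameters $m,l\ge 1$ (positive integers) are words $\mathcal{F}_n$ in two letters $A,B$ generated by the substitution $A\to A^mB^l$, $B\to A$, starting from $\mathcal{F}_0=B$, $\mathcal{F}_1=A$. To each frequency $\omega$ are associated transfer matrices $T_n(\omega)\in\mathbb{R}^{2\times 2}$ with $\det T_n(\omega)=1$, where $T_0$ is the transfer matrix of the element $B$, $T_1$ that of the element $A$, and $T_{n+1}=T_{n-1}^{\,l}\,T_n^{\,m}$ for $n\geq 1$. The super band gap is $\mathcal{S}_N:=\{\omega\in\mathbb{R}: |x_n(\omega)|>2 \text{ for all } n\geq N\}$, where $x_n(\omega)=\operatorname{tr}(T_n(\omega))$. *)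

theory Defs
  imports "HOL-Analysis.Analysis"
begin

fun d_poly :: "nat \<Rightarrow> real \<Rightarrow> real" where
  "d_poly 0 x = 0"
| "d_poly (Suc 0) x = 1"
| "d_poly (Suc (Suc k)) x = x * d_poly (Suc k) x - d_poly k x"

datatype letter = A | B

fun subst_letter :: "nat \<Rightarrow> nat \<Rightarrow> letter \<Rightarrow> letter list" where
  "subst_letter m l A = replicate m A @ replicate l B"
| "subst_letter m l B = [A]"

definition fib_tiling :: "nat \<Rightarrow> nat \<Rightarrow> nat \<Rightarrow> letter list" where
  "fib_tiling m l n = ((\<lambda>w. concat (map (subst_letter m l) w)) ^^ n) [B]"

(* Powers with respect to the matrix product: on real^2^2 the operator (^) is componentwise. *)
definition mat_power :: "real^2^2 \<Rightarrow> nat \<Rightarrow> real^2^2" where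
  "mat_power M k = (((**) M) ^^ k) (mat 1)"

(* M a w is the transfer matrix of the element a at frequency w. *)
fun transfer :: "nat \<Rightarrow> nat \<Rightarrow> (letter \<Rightarrow> real \<Rightarrow> real^2^2) \<Rightarrow> nat \<Rightarrow> real \<Rightarrow> real^2^2" where
  "transfer m l M 0 w = M B w"
| "transfer m l M (Suc 0) w = M A w"
| "transfer m l M (Suc (Suc n)) w =
     mat_power (transfer m l M n w) l ** mat_power (transfer m l M (Suc n) w) m"

definition x_tr :: "nat \<Rightarrow> nat \<Rightarrow> (letter \<Rightarrow> real \<Rightarrow> real^2^2) \<Rightarrow> nat \<Rightarrow> real \<Rightarrow> real" where
  "x_tr m l M n w = trace (transfer m l M n w)"

(* Only meaningful for n >= 2, because of the truncated subtraction. *)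
definition t_tr :: "nat \<Rightarrow> nat \<Rightarrow> (letter \<Rightarrow> real \<Rightarrow> real^2^2) \<Rightarrow> nat \<Rightarrow> real \<Rightarrow> real" where
  "t_tr m l M n w = trace (transfer m l M (n - 2) w ** transfer m l M (n - 1) w)"

definition super_band_gap :: "nat \<Rightarrow> nat \<Rightarrow> (letter \<Rightarrow> real \<Rightarrow> real^2^2) \<Rightarrow> nat \<Rightarrow> real set" where
  "super_band_gap m l M N = {w. \<forall>n\<ge>N. \<bar>x_tr m l M n w\<bar> > 2}"

(* The transfer matrix of a word: the matrix of its first element acts first. *)
fun word_transfer :: "(letter \<Rightarrow> real \<Rightarrow> real^2^2) \<Rightarrow> letter list \<Rightarrow> real \<Rightarrow> real^2^2" where
  "word_transfer M [] w = mat 1"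
| "word_transfer M (a # u) w = word_transfer M u w ** M a w"

lemma mat_power_0: "mat_power M 0 = mat 1"
  and mat_power_Suc: "mat_power M (Suc k) = M ** mat_power M k"
  by (simp_all add: mat_power_def)

lemma mat_power_1: "mat_power M (Suc 0) = M"
  by (simp add: mat_power_0 mat_power_Suc)

lemma mat_power_Suc2: "mat_power M (Suc k) = mat_power M k ** M"
  by (induction k) (simp_all add: mat_power_0 mat_power_Suc matrix_mul_assoc)

lemma fib_tiling_rec:
  "fib_tiling m l 0 = [B]"
  "fib_tiling m l (Suc 0) = [A]"
  "fib_tiling m l (Suc (Suc n)) =
     concat (replicate m (fib_tiling m l (Suc n))) @ concat (replicate l (fib_tiling m l n))"
proof -
  let ?s = "\<lambda>w. concat (map (subst_letter m l) w)"
  show F0: "fib_tiling m l 0 = [B]" by (simp add: fib_tiling_def)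
  show F1: "fib_tiling m l (Suc 0) = [A]" by (simp add: fib_tiling_def)
  have S: "fib_tiling m l (Suc k) = ?s (fib_tiling m l k)" for k
    by (simp add: fib_tiling_def)
  have R: "?s (concat (replicate k u)) = concat (replicate k (?s u))" for k u
    by (induction k) simp_all
  have C: "concat (replicate k [a]) = replicate k a" for k and a :: letter
    by (induction k) simp_all
  show "fib_tiling m l (Suc (Suc n)) =
     concat (replicate m (fib_tiling m l (Suc n))) @ concat (replicate l (fib_tiling m l n))"
  proof (induction n)
    case 0
    show ?case unfolding S[of "Suc 0"] F1 F0 by (simp add: C)
  next
    case (Suc n)
    have "fib_tiling m l (Suc (Suc (Suc n))) = ?s (fib_tiling m l (Suc (Suc n)))" by (rule S)
    also have "\<dots> = ?s (concat (replicate m (fib_tiling m l (Suc n)))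
        @ concat (replicate l (fib_tiling m l n)))" by (simp only: Suc)
    also have "\<dots> = ?s (concat (replicate m (fib_tiling m l (Suc n))))
        @ ?s (concat (replicate l (fib_tiling m l n)))" by simp
    finally show ?case by (simp only: R S)
  qed
qed

lemma word_transfer_append:
  "word_transfer M (u @ v) w = word_transfer M v w ** word_transfer M u w"
  by (induction u) (simp_all add: matrix_mul_assoc)

lemma word_transfer_replicate:
  "word_transfer M (concat (replicate k u)) w = mat_power (word_transfer M u w) k"
  by (induction k) (simp_all add: mat_power_0 mat_power_Suc2 word_transfer_append)

theorem transfer_eq_word_transfer:
  "transfer m l M n w = word_transfer M (fib_tiling m l n) w"
  by (induction m l M n w rule: transfer.induct)
    (simp_all add: fib_tiling_rec word_transfer_append word_transfer_replicate)

lemma det_mat_power: "det (M :: real^2^2) = 1 \<Longrightarrow> det (mat_power M k) = 1"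
  by (induction k) (simp_all add: mat_power_0 mat_power_Suc det_mul)

lemma det_transfer:
  assumes "\<And>a. det (M a w) = 1"
  shows "det (transfer m l M n w) = 1"
  using assms
  by (induction m l M n w rule: transfer.induct) (simp_all add: det_mul det_mat_power)

lemma mat_power_d_poly:
  fixes T :: "real^2^2"
  assumes "det T = 1"
  shows "mat_power T (Suc k) = d_poly (Suc k) (trace T) *\<^sub>R T - d_poly k (trace T) *\<^sub>R mat 1"
proof (induction k)
  case 0
  show ?case by (simp add: mat_power_1)
next
  case (Suc k)
  have CH: "T ** T = trace T *\<^sub>R T - mat 1"
    using assms
    by (simp add: vec_eq_iff forall_2 matrix_matrix_mult_def sum_2 trace_def mat_def det_2
        algebra_simps)
  have "mat_power T (Suc (Suc k)) =
      T ** (d_poly (Suc k) (trace T) *\<^sub>R T - d_poly k (trace T) *\<^sub>R mat 1)"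
    by (subst mat_power_Suc) (simp only: Suc)
  also have "\<dots> = d_poly (Suc k) (trace T) *\<^sub>R (T ** T) - d_poly k (trace T) *\<^sub>R T"
    by (simp add: vec_eq_iff forall_2 matrix_matrix_mult_def sum_2 mat_def algebra_simps)
  finally show ?case
    unfolding CH by (simp add: algebra_simps)
qed

lemma trace_mult_mat_power:
  fixes S T :: "real^2^2"
  assumes "det T = 1"
  shows "trace (S ** mat_power T (Suc k)) =
    d_poly (Suc k) (trace T) * trace (S ** T) - d_poly k (trace T) * trace S"
  unfolding mat_power_d_poly[OF assms]
  by (simp add: trace_def matrix_matrix_mult_def sum_2 mat_def algebra_simps)

(* The recursion relation for l = 1. *)
theorem x_tr_rec:
  assumes "\<And>a. det (M a w) = 1" "m \<ge> 1" "n \<ge> 1"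
  shows "x_tr m 1 M (n + 1) w =
    d_poly m (x_tr m 1 M n w) * t_tr m 1 M (n + 1) w
    - d_poly (m - 1) (x_tr m 1 M n w) * x_tr m 1 M (n - 1) w"
proof -
  obtain i k where n: "n = Suc i" and m: "m = Suc k"
    using assms(2,3) by (cases n; cases m) auto
  show ?thesis
    using trace_mult_mat_power[OF det_transfer[where M=M and w=w and m=m and l=1 and n="Suc i"],
        of "transfer m 1 M i w" k] assms(1)
    by (simp add: x_tr_def t_tr_def n m mat_power_1)
qed

theorem t_tr_rec:
  assumes "\<And>a. det (M a w) = 1" "n \<ge> 2"
  shows "t_tr m 1 M (n + 1) w =
    d_poly (m + 1) (x_tr m 1 M (n - 1) w) * t_tr m 1 M n w
    - d_poly m (x_tr m 1 M (n - 1) w) * x_tr m 1 M (n - 2) w"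
proof -
  obtain i where n: "n = Suc (Suc i)"
  proof
    show "n = Suc (Suc (n - 2))" using assms(2) by linarith
  qed
  let ?S = "transfer m 1 M i w" and ?T = "transfer m 1 M (Suc i) w"
  have "t_tr m 1 M (n + 1) w = trace (?T ** (?S ** mat_power ?T m))"
    by (simp add: t_tr_def n mat_power_1)
  also have "\<dots> = trace ((?S ** mat_power ?T m) ** ?T)"
    by (rule trace_mul_sym)
  also have "\<dots> = trace (?S ** mat_power ?T (Suc m))"
    by (simp only: mat_power_Suc2 matrix_mul_assoc)
  also have "\<dots> = d_poly (Suc m) (trace ?T) * trace (?S ** ?T) - d_poly m (trace ?T) * trace ?S"
    by (rule trace_mult_mat_power, rule det_transfer, rule assms(1))
  finally show ?thesis
    by (simp only: x_tr_def t_tr_def n) simp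
qed

end

theory Submission
  imports Defs
begin

text \<open>
  Eliminating \<open>t\<close> from the two recursions leaves a recursion for the traces alone. For four
  consecutive traces \<open>a\<close>, \<open>b\<close>, \<open>c\<close>, \<open>e\<close>,
  \[ e \, d_m(b) = d_m(c) (d_{m+1}(b)\, c - a) - d_{m-1}(c)\, b\, d_m(b), \]
  where \<open>d\<^sub>m\<^sub>+\<^sub>1 d\<^sub>m\<^sub>-\<^sub>1 - d\<^sub>m\<^sup>2 = -1\<close> has reduced the coefficient of \<open>a\<close> in the bracket to \<open>-1\<close>
  (\<open>x_tr_four_term\<close>). The term containing \<open>c\<close> dominates: outside \<open>[-2, 2]\<close> the sequence
  \<open>\<bar>d\<^sub>k(x)\<bar>\<close> is nondecreasing and grows by a factor of at least \<open>\<bar>x\<bar> - 1\<close> at each step, so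
  if \<open>\<bar>d\<^sub>m(c)\<bar> \<ge> r \<bar>d\<^sub>m\<^sub>-\<^sub>1(c)\<bar>\<close> and \<open>\<bar>d\<^sub>m\<^sub>+\<^sub>1(b)\<bar> \<ge> s \<bar>d\<^sub>m(b)\<bar>\<close>, then the triangle inequality
  together with \<open>\<bar>a\<bar> \<le> \<bar>b\<bar> \<le> \<bar>d\<^sub>m(b)\<bar>\<close> and \<open>\<bar>b\<bar> \<le> \<bar>c\<bar>\<close> gives
  \[ |e| \ge |d_{m-1}(c)| \, (r (s |c| - 1) - |c|). \]
  Hence \<open>\<bar>e\<bar> \<ge> \<bar>d\<^sub>m\<^sub>-\<^sub>1(c) c\<bar>\<close> as soon as \<open>r (s \<bar>c\<bar> - 1) \<ge> 2 \<bar>c\<bar>\<close> (\<open>dominant_term_bound\<close>).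

  Two cases provide such \<open>r\<close> and \<open>s\<close>. For \<open>m = 2\<close> the traces may be arbitrarily close to 2,
  where the general growth factor \<open>\<bar>x\<bar> - 1\<close> is too weak, but the explicit polynomials
  \<open>d\<^sub>2(x) = x\<close> and \<open>d\<^sub>3(x) = x\<^sup>2 - 1\<close> yield \<open>r = \<bar>c\<bar>\<close> and \<open>s = 3/2\<close>; the required
  inequality is then sharp at \<open>\<bar>c\<bar> = 2\<close>. For \<open>m \<ge> 3\<close> the hypothesis on \<open>a\<close> and \<open>b\<close> gives
  \<open>\<bar>b\<bar> \<ge> \<bar>a\<bar>\<^sup>2 \<ge> 4\<close>, so the general growth factor yields \<open>r = s = 3\<close>. An induction on the
  index then propagates the growth condition, which also keeps \<open>\<bar>x\<^sub>n\<bar>\<close> nondecreasing.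
\<close>

text \<open>The analogue for \<open>d\<close> of the Cassini identity of Fibonacci numbers: the determinant of
  consecutive terms of a recursion with companion matrix of determinant 1 is constant.\<close>

lemma d_poly_cassini:
  "d_poly (Suc (Suc k)) x * d_poly k x - (d_poly (Suc k) x)\<^sup>2 = -1"
proof (induction k)
  case 0
  show ?case by simp
next
  case (Suc k)
  have "d_poly (Suc (Suc (Suc k))) x * d_poly (Suc k) x - (d_poly (Suc (Suc k)) x)\<^sup>2
      = d_poly (Suc (Suc k)) x * d_poly k x - (d_poly (Suc k) x)\<^sup>2"
    by (simp add: power2_eq_square algebra_simps)
  then show ?case using Suc by simp
qed

lemma abs_d_poly_mono_Suc:
  assumes "\<bar>x\<bar> \<ge> 2"
  shows "\<bar>d_poly k x\<bar> \<le> \<bar>d_poly (Suc k) x\<bar>"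
proof (induction k)
  case 0
  show ?case by simp
next
  case (Suc k)
  have "2 * \<bar>d_poly (Suc k) x\<bar> \<le> \<bar>x * d_poly (Suc k) x\<bar>"
    using assms by (simp add: abs_mult mult_right_mono)
  then show ?case using Suc by simp
qed

lemma abs_d_poly_growth:
  assumes "\<bar>x\<bar> \<ge> 2"
  shows "\<bar>d_poly (Suc (Suc k)) x\<bar> \<ge> (\<bar>x\<bar> - 1) * \<bar>d_poly (Suc k) x\<bar>"
proof -
  have "\<bar>d_poly (Suc (Suc k)) x\<bar> \<ge> \<bar>x\<bar> * \<bar>d_poly (Suc k) x\<bar> - \<bar>d_poly k x\<bar>"
    by (simp flip: abs_mult)
  then show ?thesis
    using abs_d_poly_mono_Suc[OF assms, of k] by (simp add: left_diff_distrib)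
qed

lemma abs_d_poly_ge_one:
  assumes "\<bar>x\<bar> \<ge> 2"
  shows "\<bar>d_poly (Suc k) x\<bar> \<ge> 1"
proof (induction k)
  case (Suc k)
  then show ?case using abs_d_poly_mono_Suc[OF assms, of "Suc k"] by linarith
qed simp

lemma abs_d_poly_ge_abs:
  assumes "\<bar>x\<bar> \<ge> 2"
  shows "\<bar>d_poly (Suc (Suc k)) x\<bar> \<ge> \<bar>x\<bar>"
proof (induction k)
  case (Suc k)
  then show ?case using abs_d_poly_mono_Suc[OF assms, of "Suc (Suc k)"] by linarith
qed simp

text \<open>The growth condition forces the absolute values of the traces to be nondecreasing.\<close>

lemma abs_le_if_growth:
  assumes "\<bar>a\<bar> \<ge> 2" "\<bar>b\<bar> \<ge> \<bar>d_poly (Suc k) a * a\<bar>"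
  shows "\<bar>a\<bar> \<le> \<bar>b\<bar>"
proof -
  have "1 * \<bar>a\<bar> \<le> \<bar>d_poly (Suc k) a\<bar> * \<bar>a\<bar>"
    using abs_d_poly_ge_one[OF assms(1)] by (intro mult_right_mono) auto
  then show ?thesis using assms(2) by (simp add: abs_mult)
qed

text \<open>Solving the recursion of \<open>x\<close> for \<open>t\<close> requires a division by \<open>d\<^sub>m\<close>, which may vanish;
  multiplying through by it makes the identity hold at every frequency.\<close>

lemma x_tr_four_term:
  fixes M :: "letter \<Rightarrow> real \<Rightarrow> real^2^2"
  assumes "\<And>a. det (M a w) = 1" and "m \<ge> 1"
  defines "x \<equiv> \<lambda>n. x_tr m 1 M n w"
  shows "x (n + 3) * d_poly m (x (n + 1)) =
      d_poly m (x (n + 2)) * (d_poly (m + 1) (x (n + 1)) * x (n + 2) - x n)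
      - d_poly (m - 1) (x (n + 2)) * x (n + 1) * d_poly m (x (n + 1))"
proof -
  define t where "t = (\<lambda>n. t_tr m 1 M n w)"
  let ?b = "x (n + 1)"
  have x2: "x (n + 2) = d_poly m ?b * t (n + 2) - d_poly (m - 1) ?b * x n"
    using x_tr_rec[where M=M and w=w and m=m and n="n + 1", OF assms(1,2)]
    by (simp add: x_def t_def)
  have x3: "x (n + 3) = d_poly m (x (n + 2)) * t (n + 3) - d_poly (m - 1) (x (n + 2)) * ?b"
    using x_tr_rec[where M=M and w=w and m=m and n="n + 2", OF assms(1,2)]
    by (simp add: x_def t_def numeral_3_eq_3)
  have t3: "t (n + 3) = d_poly (m + 1) ?b * t (n + 2) - d_poly m ?b * x n"
    using t_tr_rec[where M=M and w=w and m=m and n="n + 2", OF assms(1)]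
    by (simp add: x_def t_def numeral_3_eq_3)
  have cassini: "d_poly (m + 1) ?b * d_poly (m - 1) ?b = (d_poly m ?b)\<^sup>2 - 1"
    using d_poly_cassini[of "m - 1" ?b] assms(2) by simp
  have "t (n + 3) * d_poly m ?b
      = d_poly (m + 1) ?b * (d_poly m ?b * t (n + 2)) - (d_poly m ?b)\<^sup>2 * x n"
    by (simp only: t3) (simp add: power2_eq_square algebra_simps)
  also have "\<dots> = d_poly (m + 1) ?b * x (n + 2)
      + (d_poly (m + 1) ?b * d_poly (m - 1) ?b) * x n - (d_poly m ?b)\<^sup>2 * x n"
  proof -
    have "d_poly m ?b * t (n + 2) = x (n + 2) + d_poly (m - 1) ?b * x n"
      using x2 by simp
    then show ?thesis by (simp only: distrib_left mult.assoc)
  qed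
  also have "\<dots> = d_poly (m + 1) ?b * x (n + 2) - x n"
    by (simp only: cassini) (simp add: algebra_simps)
  finally have t3': "t (n + 3) * d_poly m ?b = d_poly (m + 1) ?b * x (n + 2) - x n" .
  have "x (n + 3) * d_poly m ?b = d_poly m (x (n + 2)) * (t (n + 3) * d_poly m ?b)
      - d_poly (m - 1) (x (n + 2)) * ?b * d_poly m ?b"
    by (simp only: x3) (simp add: algebra_simps)
  then show ?thesis by (simp only: t3')
qed

text \<open>The estimate of the four-term recursion in the abstract, with \<open>p = d\<^sub>m(b)\<close>,
  \<open>p' = d\<^sub>m\<^sub>+\<^sub>1(b)\<close>, \<open>q = d\<^sub>m\<^sub>-\<^sub>1(c)\<close> and \<open>q' = d\<^sub>m(c)\<close>. The growth factors \<open>r\<close> and \<open>s\<close>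
  let everything be compared with \<open>\<bar>q\<bar> \<bar>p\<bar>\<close>, where \<open>\<bar>p\<bar>\<close> cancels against the left-hand
  side.\<close>

lemma dominant_term_bound:
  fixes a b c e p p' q q' r s :: real
  assumes eq: "e * p = q' * (p' * c - a) - q * b * p"
    and p: "\<bar>a\<bar> \<le> \<bar>p\<bar>" "p \<noteq> 0"
    and bc: "\<bar>b\<bar> \<le> \<bar>c\<bar>"
    and q': "r * \<bar>q\<bar> \<le> \<bar>q'\<bar>" and p': "s * \<bar>p\<bar> \<le> \<bar>p'\<bar>"
    and r: "0 \<le> r" and rs: "2 * \<bar>c\<bar> \<le> r * (s * \<bar>c\<bar> - 1)"
  shows "\<bar>q * c\<bar> \<le> \<bar>e\<bar>"
proof -
  have sc: "0 \<le> s * \<bar>c\<bar> - 1 \<or> r = 0"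
    using rs r by (smt (verit, ccfv_threshold) mult_nonneg_nonpos mult_pos_neg)
  have inner: "\<bar>p\<bar> * (s * \<bar>c\<bar> - 1) \<le> \<bar>p' * c - a\<bar>"
  proof -
    have "s * \<bar>p\<bar> * \<bar>c\<bar> \<le> \<bar>p' * c\<bar>"
      using mult_right_mono[OF p', of "\<bar>c\<bar>"] by (simp add: abs_mult)
    then show ?thesis using p(1) by (simp add: algebra_simps)
  qed
  have outer: "r * \<bar>q\<bar> * (\<bar>p\<bar> * (s * \<bar>c\<bar> - 1)) \<le> \<bar>q'\<bar> * \<bar>p' * c - a\<bar>"
  proof (cases "r = 0")
    case False
    then show ?thesis using q' inner sc by (intro mult_mono) auto
  qed simp
  have "\<bar>q\<bar> * \<bar>p\<bar> * (2 * \<bar>c\<bar>) \<le> \<bar>q\<bar> * \<bar>p\<bar> * (r * (s * \<bar>c\<bar> - 1))"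
    using rs by (intro mult_left_mono) auto
  also have "\<dots> \<le> \<bar>q'\<bar> * \<bar>p' * c - a\<bar>"
    using outer by (simp add: algebra_simps)
  also have "\<dots> = \<bar>e * p + q * b * p\<bar>"
    by (simp add: eq flip: abs_mult)
  also have "\<dots> \<le> \<bar>e\<bar> * \<bar>p\<bar> + \<bar>q\<bar> * \<bar>b\<bar> * \<bar>p\<bar>"
    by (simp flip: abs_mult)
  also have "\<dots> \<le> \<bar>e\<bar> * \<bar>p\<bar> + \<bar>q\<bar> * \<bar>c\<bar> * \<bar>p\<bar>"
    using bc by (intro add_left_mono mult_right_mono mult_left_mono) auto
  finally have "(\<bar>q\<bar> * \<bar>c\<bar>) * \<bar>p\<bar> \<le> \<bar>e\<bar> * \<bar>p\<bar>"
    by (simp add: algebra_simps)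
  then show ?thesis using p(2) by (simp add: abs_mult)
qed

lemma growth_step:
  fixes a b c e :: real
  assumes m: "m \<ge> 2" and a: "\<bar>a\<bar> > 2"
    and ab: "\<bar>b\<bar> \<ge> \<bar>d_poly (m - 1) a * a\<bar>"
    and bc: "\<bar>c\<bar> \<ge> \<bar>d_poly (m - 1) b * b\<bar>"
    and eq: "e * d_poly m b =
      d_poly m c * (d_poly (m + 1) b * c - a) - d_poly (m - 1) c * b * d_poly m b"
  shows "\<bar>e\<bar> \<ge> \<bar>d_poly (m - 1) c * c\<bar>"
proof -
  obtain k where k: "m = Suc (Suc k)"
    using m by (metis One_nat_def Suc_1 Suc_le_D Suc_le_mono)
  have le_ab: "\<bar>a\<bar> \<le> \<bar>b\<bar>"
    using abs_le_if_growth[where a=a and b=b and k=k] a ab k by simp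
  have le_bc: "\<bar>b\<bar> \<le> \<bar>c\<bar>"
    using abs_le_if_growth[where a=b and b=c and k=k] a le_ab bc k by simp
  have b2: "\<bar>b\<bar> \<ge> 2" and c2: "\<bar>c\<bar> \<ge> 2"
    using a le_ab le_bc by linarith+
  have p: "\<bar>b\<bar> \<le> \<bar>d_poly m b\<bar>"
    using abs_d_poly_ge_abs[OF b2, of k] k by simp
  obtain r s where "0 \<le> r" and "r * \<bar>d_poly (m - 1) c\<bar> \<le> \<bar>d_poly m c\<bar>"
    and "s * \<bar>d_poly m b\<bar> \<le> \<bar>d_poly (m + 1) b\<bar>" and "2 * \<bar>c\<bar> \<le> r * (s * \<bar>c\<bar> - 1)"
  proof (cases k)
    case 0
    have "3 / 2 * \<bar>b\<bar> \<le> \<bar>b * b - 1\<bar>"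
    proof -
      \<comment> \<open>\<open>y\<^sup>2 - 3/2 y - 1 = (y - 2) (y + 1/2)\<close> for \<open>y = \<bar>b\<bar>\<close>\<close>
      have "0 \<le> (\<bar>b\<bar> - 2) * (\<bar>b\<bar> + 1 / 2)"
        using b2 by (intro mult_nonneg_nonneg) auto
      then have "3 / 2 * \<bar>b\<bar> \<le> b * b - 1"
        by (simp add: algebra_simps)
      then show ?thesis by linarith
    qed
    moreover have "2 * \<bar>c\<bar> \<le> \<bar>c\<bar> * (3 / 2 * \<bar>c\<bar> - 1)"
      using mult_left_mono[of 2 "3 / 2 * \<bar>c\<bar> - 1" "\<bar>c\<bar>"] c2 by simp
    ultimately show ?thesis
      using that[of "\<bar>c\<bar>" "3 / 2"] k 0 by (simp add: numeral_2_eq_2)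
  next
    case (Suc j)
    have "\<bar>b\<bar> \<ge> 4"
    proof -
      have "2 * 2 \<le> \<bar>a\<bar> * \<bar>a\<bar>"
        using a by (intro mult_mono) auto
      also have "\<dots> \<le> \<bar>d_poly (m - 1) a\<bar> * \<bar>a\<bar>"
        using abs_d_poly_ge_abs[of a j] a k Suc by (intro mult_right_mono) auto
      finally show ?thesis using ab by (simp add: abs_mult)
    qed
    then have "\<bar>c\<bar> \<ge> 4" using le_bc by linarith
    have growth: "3 * \<bar>d_poly (Suc i) y\<bar> \<le> \<bar>d_poly (Suc (Suc i)) y\<bar>" if "\<bar>y\<bar> \<ge> 4" for i y
    proof -
      have "3 * \<bar>d_poly (Suc i) y\<bar> \<le> (\<bar>y\<bar> - 1) * \<bar>d_poly (Suc i) y\<bar>"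
        using that by (intro mult_right_mono) auto
      then show ?thesis using abs_d_poly_growth[of y i] that by linarith
    qed
    show ?thesis
      using that[of 3 3] growth[OF \<open>\<bar>c\<bar> \<ge> 4\<close>, of k] growth[OF \<open>\<bar>b\<bar> \<ge> 4\<close>, of "Suc k"]
        \<open>\<bar>c\<bar> \<ge> 4\<close> k by (simp del: d_poly.simps)
  qed
  moreover have "\<bar>a\<bar> \<le> \<bar>d_poly m b\<bar>" and "d_poly m b \<noteq> 0"
    using p le_ab b2 by auto
  ultimately show ?thesis
    using dominant_term_bound[OF eq] le_bc by blast
qed

theorem theorem3p10:
  fixes M :: "letter \<Rightarrow> real \<Rightarrow> real^2^2" and m N :: nat and \<omega> :: real
  assumes det_one: "\<And>a w. det (M a w) = 1"
    and m: "m \<ge> 2"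
    and N0: "\<bar>x_tr m 1 M N \<omega>\<bar> > 2"
    and N1: "\<bar>x_tr m 1 M (N + 1) \<omega>\<bar>
               \<ge> \<bar>d_poly (m - 1) (x_tr m 1 M N \<omega>) * x_tr m 1 M N \<omega>\<bar>"
    and N2: "\<bar>x_tr m 1 M (N + 2) \<omega>\<bar>
               \<ge> \<bar>d_poly (m - 1) (x_tr m 1 M (N + 1) \<omega>) * x_tr m 1 M (N + 1) \<omega>\<bar>"
  shows "(\<forall>n>N. \<bar>x_tr m 1 M (n + 1) \<omega>\<bar>
               \<ge> \<bar>d_poly (m - 1) (x_tr m 1 M n \<omega>) * x_tr m 1 M n \<omega>\<bar>)
         \<and> (\<forall>n\<ge>N. \<bar>x_tr m 1 M n \<omega>\<bar> > 2)
         \<and> \<omega> \<in> super_band_gap m 1 M N"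
proof -
  define x where "x = (\<lambda>n. x_tr m 1 M n \<omega>)"
  let ?G = "\<lambda>n. \<bar>d_poly (m - 1) (x n) * x n\<bar> \<le> \<bar>x (n + 1)\<bar>"
  have inv: "2 < \<bar>x n\<bar> \<and> ?G n \<and> ?G (n + 1)" if "n \<ge> N" for n
    using that
  proof (induction n rule: dec_induct)
    case base
    show ?case using N0 N1 N2 by (simp add: x_def)
  next
    case (step n)
    have "Suc (m - 2) = m - 1" using m by simp
    then have "\<bar>x n\<bar> \<le> \<bar>x (n + 1)\<bar>"
      using abs_le_if_growth[where a="x n" and b="x (n + 1)" and k="m - 2"] step.IH by simp
    moreover have "?G (n + 2)"
      using growth_step[OF m, of "x n" "x (n + 1)" "x (n + 2)" "x (n + 3)"]
        x_tr_four_term[where M=M and w=\<omega> and m=m and n=n, OF det_one] step.IH m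
      by (simp add: x_def numeral_3_eq_3)
    ultimately show ?case using step.IH by simp
  qed
  then show ?thesis
    by (simp add: super_band_gap_def x_def)
qed

end
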